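(* Let $f^{1},\dots,f^{n}$ be smooth real-valued functions of $x=(x^{1},\dots,x^{n})$ with $f^{i}(0,\dots,0)=0$ for all $i$, and consider the system $\frac{dx^{i}}{dt}=f^{i}(x^{1},\dots,x^{n})$, $i=1,\dots,n$. Let $A=\left(\frac{\partial f^{i}}{\partial x^{j}}\right)_{i,j}\Big|_{(0,\dots,0)}$ and let $p(\lambda)$ be the characteristic polynomial of $A$. The steady state $(0,\dots,0)$ is Jacobi stable if and only if the following three conditions all hold: (i) the dimension $n$ is even; (ii) all roots of $p(\lambda)=0$ are non-real, i.e. (counted with multiplicity) they form $n/2$ complex conjugate pairs $\lambda_{j}=\alpha_{j}+i\beta_{j}$, $\bar\lambda_{j}=\alpha_{j}-i\beta_{j}$, with $\alpha_j,\beta_j\in\mathbb{R}$, $\beta_{j}\neq0$, $j=1,\dots,n/2$; (iii) for every $j=1,\dots,n/2$ we have $\alpha_{j}^{2}-\beta_{j}^{2}<0$.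
   Context: For a second order system $\frac{d^{2}x^{i}}{dt^{2}}+2G^{i}(x,y,t)=0$, $i=1,\dots,n$, with $y^{i}=\frac{dx^{i}}{dt}$ and $G^i$ smooth functions of the independent coordinates $(x,y,t)$, define $N^{i}_{j}=\frac{\partial G^{i}}{\partial y^{j}}$, $G^{i}_{jl}=\frac{\partial N^{i}_{j}}{\partial y^{l}}$, and the curvature deviation tensor (summation over the repeated index $l$) $$P^{i}_{j}=-2\frac{\partial G^{i}}{\partial x^{j}}-2G^{l}G^{i}_{jl}+y^{l}\frac{\partial N^{i}_{j}}{\partial x^{l}}+N^{i}_{l}N^{l}_{j}+\frac{\partial N^{i}_{j}}{\partial t}.$$ The curvature deviation tensor $P=(P^{i}_{j})$ of a first order system $\frac{dx^{i}}{dt}=f^{i}(x)$ is that of the second order system obtained by differentiating it once with respect to $t$, i.e. the one with $G^{i}(x,y)=-\frac12\sum_{k=1}^{n}\frac{\partial f^{i}}{\partial x^{k}}(x)\,y^{k}$. $P|_{(0,\dots,0)}$ denotes the matrix $(P^{i}_{j})$ evaluated at $x=0$, $y=0$ (at a steady state $y^{i}=f^{i}=0$). The steady state $(0,\dots,0)$ is called Jacobi stable if all eigenvalues of $P|_{(0,\dots,0)}$ have strictly negative real part. *)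

theory Defs
  imports
    "HOL-Analysis.Analysis"
    "HOL-Computational_Algebra.Computational_Algebra"
begin

text \<open>
  Smoothness on the whole space: \<open>C_k k g\<close> says that \<open>g\<close> is continuous together with all its
  iterated directional derivatives of order at most \<open>k\<close>.
\<close>

primrec C_k :: "nat \<Rightarrow> ('a::euclidean_space \<Rightarrow> 'b::real_normed_vector) \<Rightarrow> bool" where
  "C_k 0 g \<longleftrightarrow> continuous_on UNIV g"
| "C_k (Suc k) g \<longleftrightarrow>
     (\<forall>x. g differentiable (at x)) \<and> (\<forall>v. C_k k (\<lambda>x. frechet_derivative g (at x) v))"

definition smooth :: "('a::euclidean_space \<Rightarrow> 'b::real_normed_vector) \<Rightarrow> bool" where
  "smooth g \<longleftrightarrow> (\<forall>k. C_k k g)"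

definition partial_deriv :: "'n::finite \<Rightarrow> (real ^ 'n \<Rightarrow> real) \<Rightarrow> real ^ 'n \<Rightarrow> real" where
  "partial_deriv j g x = deriv (\<lambda>s. g (x + s *\<^sub>R axis j 1)) 0"

text \<open>
  A second order system is given by \<open>G :: real ^ 'n \<Rightarrow> real ^ 'n \<Rightarrow> real \<Rightarrow> real ^ 'n\<close>, where
  \<open>G x y t $ i\<close> is the coefficient in \<open>d\<^sup>2x\<^sup>i/dt\<^sup>2 + 2 G\<^sup>i(x, y, t) = 0\<close> and \<open>x\<close>, \<open>y\<close>, \<open>t\<close> are
  independent variables.
\<close>

definition N_coeff ::
  "(real ^ 'n \<Rightarrow> real ^ 'n \<Rightarrow> real \<Rightarrow> real ^ 'n) \<Rightarrow> 'n::finite \<Rightarrow> 'n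
    \<Rightarrow> real ^ 'n \<Rightarrow> real ^ 'n \<Rightarrow> real \<Rightarrow> real" where
  "N_coeff G i j x y t = partial_deriv j (\<lambda>y. G x y t $ i) y"

definition G_coeff ::
  "(real ^ 'n \<Rightarrow> real ^ 'n \<Rightarrow> real \<Rightarrow> real ^ 'n) \<Rightarrow> 'n::finite \<Rightarrow> 'n \<Rightarrow> 'n
    \<Rightarrow> real ^ 'n \<Rightarrow> real ^ 'n \<Rightarrow> real \<Rightarrow> real" where
  "G_coeff G i j l x y t = partial_deriv l (\<lambda>y. N_coeff G i j x y t) y"

definition curvature_deviation ::
  "(real ^ 'n \<Rightarrow> real ^ 'n \<Rightarrow> real \<Rightarrow> real ^ 'n)
    \<Rightarrow> real ^ 'n \<Rightarrow> real ^ 'n \<Rightarrow> real \<Rightarrow> real ^ 'n::finite ^ 'n" where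
  "curvature_deviation G x y t = (\<chi> i j.
     - 2 * partial_deriv j (\<lambda>x. G x y t $ i) x
     - 2 * (\<Sum>l\<in>UNIV. G x y t $ l * G_coeff G i j l x y t)
     + (\<Sum>l\<in>UNIV. y $ l * partial_deriv l (\<lambda>x. N_coeff G i j x y t) x)
     + (\<Sum>l\<in>UNIV. N_coeff G i l x y t * N_coeff G l j x y t)
     + deriv (\<lambda>t. N_coeff G i j x y t) t)"

text \<open>
  Differentiating \<open>dx\<^sup>i/dt = f\<^sup>i(x)\<close> along solutions gives
  \<open>d\<^sup>2x\<^sup>i/dt\<^sup>2 = \<Sum>k. (\<partial>f\<^sup>i/\<partial>x\<^sup>k)(x) y\<^sup>k\<close>, whence the factor \<open>- 1/2\<close>.
\<close>

definition second_order_of_first_order ::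
  "(real ^ 'n \<Rightarrow> real ^ 'n) \<Rightarrow> real ^ 'n \<Rightarrow> real ^ 'n \<Rightarrow> real \<Rightarrow> real ^ 'n::finite" where
  "second_order_of_first_order f x y t =
     (\<chi> i. - (1 / 2) * (\<Sum>k\<in>UNIV. partial_deriv k (\<lambda>x. f x $ i) x * y $ k))"

definition eigenvalue :: "complex ^ 'n::finite ^ 'n \<Rightarrow> complex \<Rightarrow> bool" where
  "eigenvalue M \<mu> \<longleftrightarrow> (\<exists>v. v \<noteq> 0 \<and> M *v v = \<mu> *s v)"

text \<open>
  Jacobi stability of the steady state \<open>0\<close> of \<open>dx/dt = f(x)\<close>. The system is autonomous, so the
  quantification over the time \<open>t\<close> only avoids an arbitrary choice.
\<close>

definition jacobi_stable :: "(real ^ 'n::finite \<Rightarrow> real ^ 'n) \<Rightarrow> bool" where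
  "jacobi_stable f \<longleftrightarrow>
     (\<forall>t \<mu>. eigenvalue (map_matrix complex_of_real
                 (curvature_deviation (second_order_of_first_order f) 0 0 t)) \<mu>
            \<longrightarrow> Re \<mu> < 0)"

definition charpoly :: "'a::comm_ring_1 ^ 'n::finite ^ 'n \<Rightarrow> 'a poly" where
  "charpoly M = det (mat [:0, 1:] - map_matrix (\<lambda>c. [:c:]) M)"

end

(*
  The coefficients G are linear in y, so at x = y = 0 every term of P vanishes except N N, where
  N = - A / 2. Hence P = A^2 / 4, and its eigenvalues are z^2 / 4 for the roots z of p. Their real
  parts are (alpha^2 - beta^2) / 4, which is negative for all roots only if no root is real; the
  roots of the real polynomial p then pair off into complex conjugates.
*)
theory Submission
  imports Defs
begin

section \<open>The deviation tensor at the steady state\<close>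

text \<open>Moving along \<open>axis j 1\<close> changes \<open>G\<close> affinely in
  \<open>s\<close>, and the slope is the coefficient of the \<open>j\<close>-th component of
  \<open>y\<close>. The value depends on neither \<open>y\<close> nor \<open>t\<close>.\<close>

lemma N_coeff_second_order_of_first_order:
  "N_coeff (second_order_of_first_order f) i j x y t = - (1/2) * partial_deriv j (\<lambda>x. f x $ i) x"
proof -
  let ?c = "\<lambda>k. partial_deriv k (\<lambda>x. f x $ i) x"
  have "((\<lambda>s. - (1/2) * (\<Sum>k\<in>UNIV. ?c k * (y + s *\<^sub>R axis j 1) $ k))
      has_field_derivative - (1/2) * (\<Sum>k\<in>UNIV. ?c k * axis j 1 $ k)) (at 0)"
    by (auto intro!: derivative_eq_intros sum.cong)
  moreover have "(\<Sum>k\<in>UNIV. ?c k * axis j 1 $ k) = ?c j"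
    by (simp add: axis_def if_distrib[of "\<lambda>z. _ * z"] cong: if_cong)
  ultimately show ?thesis
    by (simp add: N_coeff_def second_order_of_first_order_def partial_deriv_def[of j] DERIV_imp_deriv)
qed

text \<open>At \<open>y = 0\<close> the coefficients \<open>G\<close> vanish for every
  \<open>x\<close>, which removes the first two terms. The third carries the factor
  \<open>y\<close>, and the last is the time derivative of a constant.\<close>

lemma curvature_deviation_steady_state:
  fixes f :: "real ^ 'n::finite \<Rightarrow> real ^ 'n"
  defines "N \<equiv> \<chi> i j. - (1/2) * partial_deriv j (\<lambda>x. f x $ i) 0"
  shows "curvature_deviation (second_order_of_first_order f) 0 0 t = N ** N"
proof -
  have [simp]: "second_order_of_first_order f x 0 t = 0" for x t
    by (simp add: second_order_of_first_order_def vec_eq_iff)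
  have [simp]: "partial_deriv j (\<lambda>x. 0) x = 0" for j :: 'n and x
    by (simp add: partial_deriv_def)
  show ?thesis
    by (simp add: curvature_deviation_def N_coeff_second_order_of_first_order N_def
        matrix_matrix_mult_def vec_eq_iff)
qed

section \<open>Eigenvalues and the characteristic polynomial\<close>

text \<open>With \<open>z\<close> a square root of \<open>\<mu>\<close>, the matrix
  \<open>B ** B - mat \<mu>\<close> factors as \<open>(B + mat z) ** (B - mat z)\<close>. An
  eigenvector \<open>v\<close> of the square is either killed by the right factor, or sent by it to
  an eigenvector of \<open>B\<close> for \<open>- z\<close>.\<close>

lemma eigenvalue_square_iff:
  "eigenvalue (B ** B) \<mu> \<longleftrightarrow> (\<exists>z. z\<^sup>2 = \<mu> \<and> eigenvalue B z)"
proof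
  assume "eigenvalue (B ** B) \<mu>"
  then obtain v where v: "v \<noteq> 0" "B *v (B *v v) = \<mu> *s v"
    by (auto simp: eigenvalue_def matrix_vector_mul_assoc)
  define z where "z = csqrt \<mu>"
  have z: "z\<^sup>2 = \<mu>" by (simp add: z_def)
  define w where "w = B *v v - z *s v"
  show "\<exists>z. z\<^sup>2 = \<mu> \<and> eigenvalue B z"
  proof (cases "w = 0")
    case True
    then have "eigenvalue B z" using v by (auto simp: eigenvalue_def w_def)
    then show ?thesis using z by blast
  next
    case False
    have "B *v w = (- z) *s w"
      using z by (simp add: w_def matrix_vector_mult_diff_distrib v vector_scalar_commute
          vec_eq_iff algebra_simps power2_eq_square flip: z)
    then have "eigenvalue B (- z)" using False by (auto simp: eigenvalue_def)
    then show ?thesis using z by (intro exI[of _ "- z"]) simp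
  qed
next
  assume "\<exists>z. z\<^sup>2 = \<mu> \<and> eigenvalue B z"
  then obtain z v where v: "z\<^sup>2 = \<mu>" "v \<noteq> 0" "B *v v = z *s v"
    by (auto simp: eigenvalue_def)
  then have "(B ** B) *v v = \<mu> *s v"
    by (simp add: matrix_vector_mul_assoc[symmetric] vector_scalar_commute power2_eq_square
        flip: v(1))
  then show "eigenvalue (B ** B) \<mu>" using v(2) by (auto simp: eigenvalue_def)
qed

lemma poly_charpoly: "poly (charpoly M) z = det (mat z - M)"
proof -
  have "poly ((mat [:0, 1:] - map_matrix (\<lambda>c. [:c:]) M) $ i $ j) z = (mat z - M) $ i $ j" for i j
    by (simp add: mat_def)
  then show ?thesis
    unfolding charpoly_def det_def by (simp add: poly_sum poly_prod)
qed

lemma eigenvalue_iff_poly_charpoly: "eigenvalue M z \<longleftrightarrow> poly (charpoly M) z = 0"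
proof -
  have "mat z *v v = z *s v" for v :: "complex ^ 'a"
    by (simp add: vec_eq_iff matrix_vector_mult_def mat_def if_distrib[of "\<lambda>a. a * _"] cong: if_cong)
  then have "M *v v = z *s v \<longleftrightarrow> (mat z - M) *v v = 0" for v
    by (auto simp: matrix_vector_mult_diff_rdistrib)
  then have "eigenvalue M z \<longleftrightarrow> \<not> invertible (mat z - M)"
    unfolding eigenvalue_def invertible_left_inverse matrix_left_invertible_ker by auto
  then show ?thesis
    by (simp add: invertible_det_nz poly_charpoly)
qed

lemma map_poly_of_real_sum:
  "map_poly (of_real :: real \<Rightarrow> 'a::real_algebra_1) (\<Sum>x\<in>S. g x) = (\<Sum>x\<in>S. map_poly of_real (g x))"
  by (intro poly_eqI) (simp add: coeff_map_poly coeff_sum)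

lemma map_poly_of_real_mult:
  "map_poly (of_real :: real \<Rightarrow> 'a::{real_algebra_1,comm_ring_1}) (p * q)
    = map_poly of_real p * map_poly of_real q"
  by (intro poly_eqI) (simp add: coeff_map_poly coeff_mult)

lemma map_poly_of_real_prod:
  "map_poly (of_real :: real \<Rightarrow> 'a::{real_algebra_1,comm_ring_1}) (\<Prod>x\<in>S. g x)
    = (\<Prod>x\<in>S. map_poly of_real (g x))"
  by (induction S rule: infinite_finite_induct) (simp_all add: map_poly_of_real_mult)

text \<open>Embedding the coefficients is a ring homomorphism, so it passes through the Leibniz
  formula term by term; the permutation signs enter as integer constants, which it fixes.\<close>

lemma map_poly_charpoly:
  "map_poly complex_of_real (charpoly A) = charpoly (map_matrix complex_of_real A)"
proof -
  have [simp]: "map_poly complex_of_real (of_int m) = of_int m" for m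
    by (simp add: of_int_poly map_poly_pCons)
  have "map_poly complex_of_real ((mat [:0, 1:] - map_matrix (\<lambda>c. [:c:]) A) $ i $ j)
      = (mat [:0, 1:] - map_matrix (\<lambda>c. [:c:]) (map_matrix complex_of_real A)) $ i $ j" for i j
    by (simp add: mat_def map_poly_pCons)
  then show ?thesis
    unfolding charpoly_def det_def
    by (simp only: map_poly_of_real_sum map_poly_of_real_mult map_poly_of_real_prod) simp
qed

text \<open>In the Leibniz formula the identity permutation gives a product of
  \<open>CARD('n)\<close> monic linear factors. Any other permutation picks at least one
  off-diagonal entry, which is constant, so its term has smaller degree and cannot cancel the
  leading one.\<close>

lemma degree_charpoly:
  fixes M :: "'a::idom ^ 'n::finite ^ 'n"
  shows "degree (charpoly M) = CARD('n)"
proof -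
  let ?X = "mat [:0, 1:] - map_matrix (\<lambda>c. [:c:]) M"
  let ?t = "\<lambda>q. of_int (sign q) * (\<Prod>i\<in>UNIV. ?X $ i $ q i)"
  let ?P = "{q. q permutes (UNIV :: 'n set)}"
  have diag: "?X $ i $ i = [:- (M $ i $ i), 1:]" for i
    by (simp add: mat_def)
  have off: "degree (?X $ i $ j) = 0" if "i \<noteq> j" for i j
    using that by (simp add: mat_def)
  have id: "degree (?t id) = CARD('n)"
    by (simp add: diag degree_prod_sum_eq del: vector_minus_component)
  have other: "degree (?t q) < CARD('n)" if nid: "q \<noteq> id" for q
  proof -
    obtain k where k: "q k \<noteq> k" using nid by (auto simp: fun_eq_iff)
    have "degree (?t q) \<le> degree (of_int (sign q) :: 'a poly) + degree (\<Prod>i\<in>UNIV. ?X $ i $ q i)"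
      by (rule degree_mult_le)
    also have "\<dots> = degree (\<Prod>i\<in>UNIV. ?X $ i $ q i)"
      by (simp add: of_int_poly)
    also have "\<dots> \<le> (\<Sum>i\<in>UNIV. degree (?X $ i $ q i))"
      using degree_prod_sum_le[of UNIV "\<lambda>i. ?X $ i $ q i"] by (simp add: o_def)
    also have "\<dots> < (\<Sum>i\<in>(UNIV :: 'n set). 1)"
    proof (rule sum_strict_mono_ex1)
      show "\<forall>i\<in>UNIV. degree (?X $ i $ q i) \<le> 1"
        by (simp add: mat_def)
      show "\<exists>i\<in>UNIV. degree (?X $ i $ q i) < 1"
        using off[of k "q k"] k by (intro bexI[of _ k]) auto
    qed simp
    finally show ?thesis by simp
  qed
  have "degree (\<Sum>q\<in>?P - {id}. ?t q) < CARD('n)"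
    by (rule degree_sum_less) (use other in auto)
  then have "degree (?t id + (\<Sum>q\<in>?P - {id}. ?t q)) = CARD('n)"
    using id by (simp only: degree_add_eq_left)
  moreover have "charpoly M = ?t id + (\<Sum>q\<in>?P - {id}. ?t q)"
    unfolding charpoly_def det_def
    by (rule sum.remove) (simp_all add: permutes_id del: id_apply)
  ultimately show ?thesis by simp
qed

section \<open>Pairing complex conjugate roots\<close>

text \<open>Conjugating all coefficients turns a factor \<open>[:- z, 1:] ^ k\<close> of
  \<open>p\<close> into the factor \<open>[:- cnj z, 1:] ^ k\<close> of the conjugated
  polynomial.\<close>

lemma order_le_order_map_poly_cnj:
  assumes "p \<noteq> 0"
  shows "order z p \<le> order (cnj z) (map_poly cnj p)"
proof -
  obtain q where q: "p = [:- z, 1:] ^ order z p * q"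
    using order_1[of z p] by (elim dvdE)
  \<comment> \<open>The factorization is compared as functions: evaluating the conjugated polynomial
    at \<open>x\<close> is conjugating the value of \<open>p\<close> at
    \<open>cnj x\<close>.\<close>
  have "poly (map_poly cnj p) x = poly ([:- cnj z, 1:] ^ order z p * map_poly cnj q) x" for x
    using arg_cong[OF q, of "\<lambda>r. cnj (poly r (cnj x))"] by simp
  then have "map_poly cnj p = [:- cnj z, 1:] ^ order z p * map_poly cnj q"
    by (simp only: poly_eq_poly_eq_iff[symmetric] fun_eq_iff) blast
  then have "[:- cnj z, 1:] ^ order z p dvd map_poly cnj p" by simp
  moreover have "map_poly cnj p \<noteq> 0" using assms by (simp add: map_poly_eq_0_iff)
  ultimately show ?thesis by (simp add: order_divides)
qed

text \<open>The preceding inequality at \<open>z\<close> and at \<open>cnj z\<close> gives both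
  directions, since conjugation is an involution.\<close>

lemma order_cnj_of_real_poly:
  assumes "p \<noteq> 0" "map_poly cnj p = p"
  shows "order (cnj z) p = order z p"
  using order_le_order_map_poly_cnj[of p z] order_le_order_map_poly_cnj[of p "cnj z"] assms
  by simp

text \<open>Links sums over \<open>j = 1..n\<close>, as used for the root pairs, with lists indexed
  from 0; hence the shift \<open>j - 1\<close>.\<close>

lemma sum_mset_nth:
  "(\<Sum>j = 1..length xs. {#g (xs ! (j - 1))#}) = image_mset g (mset xs)"
proof (induction xs rule: rev_induct)
  case (snoc x xs)
  have "(\<Sum>j = 1..length xs. {#g ((xs @ [x]) ! (j - 1))#}) = (\<Sum>j = 1..length xs. {#g (xs ! (j - 1))#})"
    by (rule sum.cong) (auto simp: nth_append)
  then show ?case using snoc by simp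
qed simp

text \<open>With no element on the real axis, \<open>M\<close> splits into its part \<open>U\<close>
  in the upper half-plane and the mirror image of \<open>U\<close>; each element of \<open>U\<close>
  then yields one pair.\<close>

lemma conjugate_pairing:
  fixes M :: "complex multiset"
  assumes cnj: "\<And>z. count M (cnj z) = count M z" and nonreal: "\<And>z. z \<in># M \<Longrightarrow> Im z \<noteq> 0"
  shows "even (size M) \<and>
    (\<exists>\<alpha> \<beta> :: nat \<Rightarrow> real.
      M = (\<Sum>j = 1..size M div 2. {# Complex (\<alpha> j) (\<beta> j), Complex (\<alpha> j) (- \<beta> j) #}))"
proof -
  define U where "U = filter_mset (\<lambda>z. Im z > 0) M"
  have count_image: "count (image_mset cnj U) z = count U (cnj z)" for z
    by (induction U) (auto simp: complex_eq_iff)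
  have count_U: "count U z = (if Im z > 0 then count M z else 0)" for z
    by (simp add: U_def)
  have M: "M = U + image_mset cnj U"
  proof (rule multiset_eqI)
    fix z show "count M z = count (U + image_mset cnj U) z"
      \<comment> \<open>On the real axis both counts are 0. Elsewhere exactly one summand can
        contribute, and for \<open>Im z < 0\<close> it does so through \<open>cnj z\<close>.\<close>
      using nonreal[of z] cnj[of z]
      by (cases "Im z = 0") (auto simp: count_image count_U count_eq_zero_iff)
  qed
  have size: "size M = 2 * size U" by (subst M) simp
  obtain xs where xs: "mset xs = U" using ex_mset by blast
  \<comment> \<open>Real and imaginary parts along an arbitrary enumeration \<open>xs\<close> of the
    upper half.\<close>
  define \<alpha> \<beta> where "\<alpha> j = Re (xs ! (j - 1))" and "\<beta> j = Im (xs ! (j - 1))" for j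
  have [simp]: "Complex (\<alpha> j) (\<beta> j) = xs ! (j - 1)" "Complex (\<alpha> j) (- \<beta> j) = cnj (xs ! (j - 1))" for j
    by (simp_all add: \<alpha>_def \<beta>_def complex_eq_iff)
  have len: "size M div 2 = length xs" using size by (simp flip: xs)
  have "(\<Sum>j = 1..size M div 2. {# Complex (\<alpha> j) (\<beta> j), Complex (\<alpha> j) (- \<beta> j) #})
      = (\<Sum>j = 1..length xs. {#id (xs ! (j - 1))#}) + (\<Sum>j = 1..length xs. {#cnj (xs ! (j - 1))#})"
    unfolding len by (simp add: add_mset_commute flip: sum.distrib)
  also have "\<dots> = M"
    unfolding sum_mset_nth xs by (subst M) simp
  finally show ?thesis using size by (metis dvd_triv_left)
qed

section \<open>Jacobi stability\<close>

text \<open>The deviation tensor is the square of \<open>N = - A / 2\<close>, so its eigenvalues are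
  the squares of those of \<open>N\<close>. Passing from \<open>N\<close> to \<open>A\<close> scales
  eigenvalues by \<open>- 2\<close> and their squares by 4, which keeps the sign of the real
  part.\<close>

lemma jacobi_stable_iff_roots:
  fixes f :: "real ^ 'n::finite \<Rightarrow> real ^ 'n"
  defines "A \<equiv> \<chi> i j. partial_deriv j (\<lambda>x. f x $ i) 0"
  shows "jacobi_stable f \<longleftrightarrow>
    (\<forall>z. poly (map_poly complex_of_real (charpoly A)) z = 0 \<longrightarrow> (Re z)\<^sup>2 - (Im z)\<^sup>2 < 0)"
proof -
  let ?B = "map_matrix complex_of_real A"
  define N where "N = (\<chi> i j. - (1/2) * partial_deriv j (\<lambda>x. f x $ i) 0)"
  let ?N = "map_matrix complex_of_real N"
  have "map_matrix complex_of_real (N ** N) = ?N ** ?N"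
    by (simp add: vec_eq_iff matrix_matrix_mult_def)
  then have P: "map_matrix complex_of_real
      (curvature_deviation (second_order_of_first_order f) 0 0 t) = ?N ** ?N" for t
    using curvature_deviation_steady_state[of f t] by (simp add: N_def)
  have "?N *v v = (- 1/2) *s (?B *v v)" for v
    by (simp add: vec_eq_iff matrix_vector_mult_def N_def A_def sum_negf sum_divide_distrib)
  then have "?N *v v = z *s v \<longleftrightarrow> (- 1/2) *s (?B *v v) = z *s v" for v z
    by simp
  moreover have "(- 1/2) *s w = z *s v \<longleftrightarrow> w = (- 2 * z) *s v" for v w :: "complex ^ 'n" and z
  proof -
    have "- a / 2 = b \<longleftrightarrow> a = - 2 * b" for a b :: complex
      by (auto simp: complex_eq_iff)
    then show ?thesis
      by (simp add: vec_eq_iff mult.assoc)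
  qed
  ultimately have "?N *v v = z *s v \<longleftrightarrow> ?B *v v = (- 2 * z) *s v" for v z
    by simp
  then have N: "eigenvalue ?N z \<longleftrightarrow> eigenvalue ?B (- 2 * z)" for z
    by (simp only: eigenvalue_def)
  have "jacobi_stable f \<longleftrightarrow> (\<forall>z. eigenvalue ?N z \<longrightarrow> Re (z\<^sup>2) < 0)"
    unfolding jacobi_stable_def P eigenvalue_square_iff by auto
  also have "\<dots> \<longleftrightarrow> (\<forall>z. eigenvalue ?B z \<longrightarrow> Re (z\<^sup>2) < 0)"
  proof safe
    fix z assume "\<forall>z. eigenvalue ?N z \<longrightarrow> Re (z\<^sup>2) < 0" "eigenvalue ?B z"
    moreover have "eigenvalue ?N (- z / 2)" using \<open>eigenvalue ?B z\<close> N[of "- z / 2"] by simp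
    ultimately have "Re ((- z / 2)\<^sup>2) < 0" by blast
    then show "Re (z\<^sup>2) < 0" by (simp add: power_divide)
  next
    fix z assume "\<forall>z. eigenvalue ?B z \<longrightarrow> Re (z\<^sup>2) < 0" "eigenvalue ?N z"
    then have "Re ((- 2 * z)\<^sup>2) < 0" using N by blast
    then show "Re (z\<^sup>2) < 0" by (simp add: power_mult_distrib)
  qed
  finally show ?thesis
    by (simp add: eigenvalue_iff_poly_charpoly map_poly_charpoly Re_power2)
qed


theorem theorem2:
  fixes f :: "real ^ 'n::finite \<Rightarrow> real ^ 'n"
    and A :: "real ^ 'n ^ 'n"
    and p :: "complex poly"
  assumes smooth: "\<And>i. smooth (\<lambda>x. f x $ i)"
    and steady: "\<And>i. f 0 $ i = 0"
    and A: "A = (\<chi> i j. partial_deriv j (\<lambda>x. f x $ i) 0)"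
    and p: "p = map_poly complex_of_real (charpoly A)"
  shows "jacobi_stable f \<longleftrightarrow>
    even CARD('n) \<and>
    (\<forall>z. poly p z = 0 \<longrightarrow> z \<notin> \<real>) \<and>
    (\<exists>\<alpha> \<beta> :: nat \<Rightarrow> real.
       proots p = (\<Sum>j = 1..CARD('n) div 2. {# Complex (\<alpha> j) (\<beta> j), Complex (\<alpha> j) (- \<beta> j) #}) \<and>
       (\<forall>j \<in> {1..CARD('n) div 2}. \<beta> j \<noteq> 0) \<and>
       (\<forall>j \<in> {1..CARD('n) div 2}. (\<alpha> j)\<^sup>2 - (\<beta> j)\<^sup>2 < 0))"
    (is "_ \<longleftrightarrow> ?cond")
proof -
  have deg: "degree p = CARD('n)" unfolding p map_poly_charpoly by (rule degree_charpoly)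
  then have p0: "p \<noteq> 0" by auto
  have stable: "jacobi_stable f \<longleftrightarrow> (\<forall>z. poly p z = 0 \<longrightarrow> (Re z)\<^sup>2 - (Im z)\<^sup>2 < 0)"
    unfolding p A by (rule jacobi_stable_iff_roots)
  show ?thesis
  proof
    assume "jacobi_stable f"
    then have neg: "(Re z)\<^sup>2 - (Im z)\<^sup>2 < 0" if "poly p z = 0" for z
      using stable that by blast
    \<comment> \<open>A real root would make the square of \<open>Re z\<close> negative.\<close>
    then have nonreal: "Im z \<noteq> 0" if "poly p z = 0" for z
      using that by fastforce
    have "map_poly cnj p = p"
      unfolding p by (intro poly_eqI) (simp add: coeff_map_poly)
    then have "count (proots p) (cnj z) = count (proots p) z" for z
      using p0 by (simp add: order_cnj_of_real_poly)
    \<comment> \<open>Over the complex numbers the number of roots with multiplicity is the degree,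
      here \<open>CARD('n)\<close>, so the pairing also shows that the dimension is even.\<close>
    then obtain \<alpha> \<beta> :: "nat \<Rightarrow> real" where ev: "even CARD('n)" and
      roots: "proots p = (\<Sum>j = 1..CARD('n) div 2. {# Complex (\<alpha> j) (\<beta> j), Complex (\<alpha> j) (- \<beta> j) #})"
      using conjugate_pairing[of "proots p"] nonreal p0 by (auto simp: size_proots_complex deg)
    have root: "poly p (Complex (\<alpha> j) (\<beta> j)) = 0" if "j \<in> {1..CARD('n) div 2}" for j
    proof -
      have "Complex (\<alpha> j) (\<beta> j) \<in># proots p"
        unfolding roots using that by (force simp: set_mset_sum)
      then show ?thesis using p0 by simp
    qed
    have "\<forall>z. poly p z = 0 \<longrightarrow> z \<notin> \<real>"
      using nonreal by (simp add: complex_is_Real_iff)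
    moreover have "\<forall>j \<in> {1..CARD('n) div 2}. \<beta> j \<noteq> 0"
      "\<forall>j \<in> {1..CARD('n) div 2}. (\<alpha> j)\<^sup>2 - (\<beta> j)\<^sup>2 < 0"
      using nonreal[OF root] neg[OF root] by simp_all
    ultimately show ?cond
      using ev roots by blast
  next
    assume ?cond
    then obtain \<alpha> \<beta> :: "nat \<Rightarrow> real" where
      roots: "proots p = (\<Sum>j = 1..CARD('n) div 2. {# Complex (\<alpha> j) (\<beta> j), Complex (\<alpha> j) (- \<beta> j) #})"
      and neg: "\<forall>j \<in> {1..CARD('n) div 2}. (\<alpha> j)\<^sup>2 - (\<beta> j)\<^sup>2 < 0"
      by blast
    have "(Re z)\<^sup>2 - (Im z)\<^sup>2 < 0" if "poly p z = 0" for z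
    proof -
      \<comment> \<open>Every root lies in one of the pairs, and both members of a pair give the
        same value of the squared real part minus the squared imaginary part.\<close>
      have "z \<in># proots p" using that p0 by simp
      then obtain j where "j \<in> {1..CARD('n) div 2}"
        "z = Complex (\<alpha> j) (\<beta> j) \<or> z = Complex (\<alpha> j) (- \<beta> j)"
        unfolding roots by (auto simp: set_mset_sum)
      then show ?thesis using neg by auto
    qed
    then show "jacobi_stable f" using stable by blast
  qed
qed

end
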